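(* Let $A\in\overline{\mathcal R}^{\,n\times n}$. Then the following are equivalent: (i) the rows of $A$ are linearly dependent; (ii) the columns of $A$ are linearly dependent; (iii) $s(\det A)=0_{\mathbb F}$.
   Context: Let $\mathbb F$ be an algebraically closed field. The ELT algebra $\mathcal R=\mathscr R(\mathbb F,\mathbb R)$ is the set of symbols ${}^{[\ell]}a$ with $a\in\mathbb R$ (tangible value) and $\ell\in\mathbb F$ (layer), with multiplication ${}^{[\ell_1]}a_1\cdot{}^{[\ell_2]}a_2={}^{[\ell_1\ell_2]}(a_1+a_2)$ and addition ${}^{[\ell_1]}a_1+{}^{[\ell_2]}a_2$ equal to ${}^{[\ell_1]}a_1$ if $a_1>a_2$, to ${}^{[\ell_2]}a_2$ if $a_1<a_2$, and to ${}^{[\ell_1+\ell_2]}a_1$ if $a_1=a_2$. Put $\overline{\mathcal R}=\mathcal R\cup\{-\infty\}$, where $-\infty$ is a formal element with $-\infty+\alpha=\alpha+(-\infty)=\alpha$ and $-\infty\cdot\alpha=\alpha\cdot(-\infty)=-\infty$ for all $\alpha$. The layer map is $s({}^{[\ell]}a)=\ell$, $s(-\infty)=0$; on vectors $s$ is applied entrywise. Let $\mathcal R^\times=\{{}^{[\ell]}a\in\mathcal R:\ell\ne0\}$. The ELT determinant of $A=(a_{i,j})$ is $\det A=\sum_{\sigma\in S_n}{}^{[\operatorname{sign}(\sigma)]}0\cdot a_{1,\sigma(1)}\cdots a_{n,\sigma(n)}$. A family of vectors in $\overline{\mathcal R}^{\,n}$ is linearly dependent if there are finitely many members $v_1,\dots,v_m$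 ($m\ge1$, distinct indices) of the family and $a_1,\dots,a_m\in\mathcal R^\times$ with $s\big(\sum_{i=1}^m a_iv_i\big)=(0,\dots,0)$. *)

theory Defs
  imports "HOL-Analysis.Analysis" "HOL-Computational_Algebra.Polynomial"
begin

text \<open>
  \<open>Elt l a\<close> is the symbol with layer \<open>l\<close> and tangible value \<open>a\<close>;
  \<open>MInf\<close> is the adjoined element \<open>-\<infinity>\<close>. The type is the extended algebra
  \<open>\<R>(F, \<real>) \<union> {-\<infinity>}\<close>. Symbols of layer \<open>0\<close> are distinct from \<open>MInf\<close>.
\<close>

datatype 'f elt = MInf | Elt 'f real

text \<open>
  \<open>-\<infinity>\<close> is the additive neutral element and hence the \<open>0\<close> of the semiring; it has to be
  distinguished from the symbols of layer \<open>0\<close>.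
\<close>

instantiation elt :: (comm_ring_1) comm_semiring_1
begin

definition zero_elt :: "'a elt" where
  "zero_elt = MInf"

definition one_elt :: "'a elt" where
  "one_elt = Elt 1 0"

fun plus_elt :: "'a elt \<Rightarrow> 'a elt \<Rightarrow> 'a elt" where
  "plus_elt MInf y = y"
| "plus_elt (Elt l a) MInf = Elt l a"
| "plus_elt (Elt l a) (Elt m b) =
     (if a > b then Elt l a else if a < b then Elt m b else Elt (l + m) a)"

fun times_elt :: "'a elt \<Rightarrow> 'a elt \<Rightarrow> 'a elt" where
  "times_elt MInf y = MInf"
| "times_elt (Elt l a) MInf = MInf"
| "times_elt (Elt l a) (Elt m b) = Elt (l * m) (a + b)"

instance
proof
  fix x y z :: "'a elt"
  show "x + y + z = x + (y + z)"
    by (cases x; cases y; cases z) (auto simp: add.assoc)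
  show "x + y = y + x"
    by (cases x; cases y) (auto simp: add.commute)
  show "0 + x = x"
    by (simp add: zero_elt_def)
  show "x * y * z = x * (y * z)"
    by (cases x; cases y; cases z) (auto simp: mult.assoc)
  show "x * y = y * x"
    by (cases x; cases y) (auto simp: mult.commute)
  show "1 * x = x"
    by (cases x) (auto simp: one_elt_def)
  show "(x + y) * z = x * z + y * z"
    by (cases x; cases y; cases z) (auto simp: distrib_right)
  show "0 * x = 0"
    by (simp add: zero_elt_def)
  show "x * 0 = 0"
    by (cases x) (auto simp: zero_elt_def)
  show "(0 :: 'a elt) \<noteq> 1"
    by (simp add: zero_elt_def one_elt_def)
qed

end

fun layer :: "'f::zero elt \<Rightarrow> 'f" where
  "layer MInf = 0"
| "layer (Elt l a) = l"

definition layer_vec :: "'f::zero elt ^ 'n \<Rightarrow> 'f ^ 'n" where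
  "layer_vec v = (\<chi> i. layer (v $ i))"

text \<open>The set \<open>\<R>\<^sup>\<times>\<close>: symbols of nonzero layer, \<open>-\<infinity>\<close> excluded.\<close>

definition elt_units :: "'f::zero elt set" where
  "elt_units = {Elt l a | l a. l \<noteq> 0}"

text \<open>
  The library's \<open>det\<close> needs a ring; here the sign of a permutation enters as the layer of a
  symbol of tangible value \<open>0\<close>.
\<close>

definition elt_det :: "'f::comm_ring_1 elt ^ 'n ^ 'n \<Rightarrow> 'f elt" where
  "elt_det A =
     (\<Sum>p \<in> {p. p permutes (UNIV :: 'n set)}.
        Elt (of_int (sign p)) 0 * (\<Prod>i\<in>UNIV. A $ i $ p i))"

text \<open>
  Dependence of an indexed family, so equal vectors at distinct indices count as distinct
  members.
\<close>

definition elt_dependent :: "('i \<Rightarrow> 'f::comm_ring_1 elt ^ 'n) \<Rightarrow> bool" where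
  "elt_dependent v \<longleftrightarrow>
     (\<exists>J a. finite J \<and> J \<noteq> {} \<and> (\<forall>i\<in>J. a i \<in> elt_units) \<and>
        layer_vec (\<Sum>i\<in>J. a i *s v i) = 0)"

end

theory Submission
  imports Defs "HOL-Library.Poly_Mapping" "HOL-Computational_Algebra.Polynomial_Factorial"
begin

text \<open>
  ELT arithmetic records leading terms. A symbol of layer \<open>l\<close> and value \<open>a\<close> stands for any element
  \<open>l t^a + (lower exponents)\<close> of the group ring \<open>F[t^\<real>]\<close>, an integral domain; layer \<open>0\<close> means that
  everything at exponent \<open>a\<close> and above has cancelled. This correspondence, \<open>lifts\<close>, respects sums and
  products, hence determinants (\<open>lifts_det\<close>). The theorem becomes a comparison with the
  classical fact that a square matrix over a domain has determinant \<open>0\<close> iff it has a nonzero kernel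
  vector (\<open>det_eq_0_iff_kernel\<close>). It suffices to treat columns, because transposing exchanges rows
  and columns and preserves the determinant.

  If the columns are dependent, lift the coefficients to monomials. In each row the lifted sum
  cancels at its top exponent, and what is left over is absorbed by changing one entry of that row
  below its leading term (\<open>lift_row_annihilated\<close>). The matrix so obtained still lifts \<open>A\<close> and kills a
  nonzero vector; its determinant is \<open>0\<close> and lifts \<open>det A\<close>, which therefore has layer \<open>0\<close>.

  Conversely, a kernel vector of a lift yields a dependence by taking leading terms. Exact vanishing
  is more than is needed: \<open>dependent_columnsI\<close> allows a row of the product to be nonzero as
  long as it has dropped below the largest value occurring in that row. If every permutation
  contributes \<open>-\<infinity>\<close>, the monomial lift is itself singular. Otherwise choose a permutation \<open>\<tau>\<close>
  of largest value and take as vector the cofactors of one row \<open>k\<close> of a lift \<open>Y\<close>. All other rows of the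
  product vanish, and row \<open>k\<close> gives \<open>det Y\<close>. That \<open>det A\<close> has layer \<open>0\<close> makes \<open>det Y\<close> small, but the
  cofactors must not drop equally far, as they can for the monomial lift when its leading part
  has corank at least \<open>2\<close>. The remedy is to add terms of value slightly below the leading ones along
  \<open>\<tau>\<close>, in just those rows that are needed to restore full rank
  (\<open>perturbation_with_small_det\<close>): every perturbed row then costs the same small \<open>\<epsilon>\<close>, and the cofactor
  in row \<open>k\<close> pays for one row less than the determinant.
\<close>

section \<open>Lifting to a group ring\<close>

abbreviation coeff_at :: "(real \<Rightarrow>\<^sub>0 'f::zero) \<Rightarrow> real \<Rightarrow> 'f" where
  "coeff_at \<equiv> Poly_Mapping.lookup"

abbreviation term_at :: "real \<Rightarrow> 'f::zero \<Rightarrow> (real \<Rightarrow>\<^sub>0 'f)" where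
  "term_at \<equiv> Poly_Mapping.single"

text \<open>
  At layer \<open>0\<close> the exponent \<open>a\<close> is only a strict upper bound for the exponents that occur in \<open>x\<close>, and
  \<open>x\<close> may vanish; \<open>-\<infinity>\<close> is lifted by \<open>0\<close> alone.
\<close>

fun lifts :: "(real \<Rightarrow>\<^sub>0 'f::zero) \<Rightarrow> 'f elt \<Rightarrow> bool" where
  "lifts x MInf \<longleftrightarrow> x = 0"
| "lifts x (Elt l a) \<longleftrightarrow> (\<forall>b>a. coeff_at x b = 0) \<and> coeff_at x a = l"

lemma coeff_at_mult:
  fixes x y :: "real \<Rightarrow>\<^sub>0 'f::comm_ring_1"
  shows "coeff_at (x * y) k = (\<Sum>l. coeff_at x l * coeff_at y (k - l))"
proof -
  have "(\<Sum>q. coeff_at y q when k = l + q) = coeff_at y (k - l)" for l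
  proof -
    have "(\<lambda>q. coeff_at y q when k = l + q) = (\<lambda>q. coeff_at y q when q = k - l)"
      by (auto simp: fun_eq_iff when_def)
    then show ?thesis by (simp only: Sum_any_when_equal)
  qed
  then show ?thesis by (simp add: lookup_mult)
qed

lemma coeff_at_term_mult:
  fixes x :: "real \<Rightarrow>\<^sub>0 'f::comm_ring_1"
  shows "coeff_at (term_at a 1 * x) k = coeff_at x (k - a)"
proof -
  have "(\<lambda>l. coeff_at (term_at a 1) l * coeff_at x (k - l)) = (\<lambda>l. coeff_at x (k - l) when l = a)"
    by (auto simp: fun_eq_iff when_def lookup_single)
  then show ?thesis by (simp only: coeff_at_mult Sum_any_when_equal)
qed

lemma lifts_add:
  assumes "lifts x e" "lifts y f"
  shows "lifts (x + y) (e + f)"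
  using assms by (cases e; cases f) (auto simp: lookup_add)

text \<open>
  At an exponent \<open>k \<ge> a + b\<close> a splitting \<open>k = p + (k - p)\<close> has \<open>p > a\<close> or \<open>k - p > b\<close>, unless both parts
  are leading exponents; hence only the product of the two leading coefficients survives.
\<close>

lemma lifts_mult:
  fixes x y :: "real \<Rightarrow>\<^sub>0 'f::comm_ring_1"
  assumes "lifts x e" "lifts y f"
  shows "lifts (x * y) (e * f)"
proof (cases e)
  case MInf
  with assms show ?thesis by simp
next
  case e: (Elt l a)
  show ?thesis
  proof (cases f)
    case MInf
    with e assms show ?thesis by simp
  next
    case f: (Elt m b)
    have *: "coeff_at x p * coeff_at y (k - p) = (l * m when p = a \<and> k = a + b)" if "k \<ge> a + b" for p k
    proof -
      have "p > a \<or> p = a \<and> k = a + b \<or> k - p > b" using that by linarith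
      then consider "p > a" | "p = a" "k = a + b" | "k - p > b" by blast
      then show ?thesis using assms e f by cases (auto simp: when_def)
    qed
    have "coeff_at (x * y) k = (l * m when k = a + b)" if "k \<ge> a + b" for k
    proof -
      have "coeff_at (x * y) k = (\<Sum>p. (l * m when k = a + b) when p = a)"
        unfolding coeff_at_mult using *[OF that] by (auto simp: when_def intro!: Sum_any.cong)
      then show ?thesis by simp
    qed
    then show ?thesis using e f by (auto simp: when_def)
  qed
qed

lemma lifts_one [simp]: "lifts 1 (1 :: 'f::comm_ring_1 elt)"
  by (auto simp: one_elt_def lookup_one when_def)

lemma lifts_zero [simp]: "lifts 0 (0 :: 'f::comm_ring_1 elt)"
  by (simp add: zero_elt_def)

lemma lifts_sum:
  fixes e :: "'i \<Rightarrow> 'f::comm_ring_1 elt"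
  assumes "\<And>i. i \<in> I \<Longrightarrow> lifts (x i) (e i)"
  shows "lifts (sum x I) (sum e I)"
  using assms by (induction I rule: infinite_finite_induct) (auto simp: lifts_add)

lemma lifts_prod:
  fixes e :: "'i \<Rightarrow> 'f::comm_ring_1 elt"
  assumes "\<And>i. i \<in> I \<Longrightarrow> lifts (x i) (e i)"
  shows "lifts (prod x I) (prod e I)"
  using assms by (induction I rule: infinite_finite_induct) (auto simp: lifts_mult)

lemma lifts_of_int: "lifts (of_int k) (Elt (of_int k :: 'f::comm_ring_1) 0)"
proof -
  have "(of_int k :: real \<Rightarrow>\<^sub>0 'f) = term_at 0 (of_int k)" by simp
  then show ?thesis by (simp only: lifts.simps lookup_single) (auto simp: when_def)
qed

text \<open>
  The bridge between ELT determinants and commutative algebra: \<open>elt_det\<close> is built from sums,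
  products and signs, and all of these are respected by lifting.
\<close>

lemma lifts_det:
  fixes A :: "'f::comm_ring_1 elt ^ 'n ^ 'n"
  assumes "\<And>i j. lifts (X $ i $ j) (A $ i $ j)"
  shows "lifts (det X) (elt_det A)"
  unfolding det_def elt_det_def
  by (intro lifts_sum lifts_mult lifts_prod lifts_of_int assms)

fun monomial :: "'f::zero elt \<Rightarrow> (real \<Rightarrow>\<^sub>0 'f)" where
  "monomial MInf = 0"
| "monomial (Elt l a) = term_at a l"

lemma lifts_monomial: "lifts (monomial e) e"
  by (cases e) (auto simp: lookup_single)

section \<open>Comparing tangible values\<close>

text \<open>
  Compares tangible values only, with \<open>-\<infinity>\<close> below every symbol; layers are ignored, so this is a
  preorder and not an order.
\<close>

fun value_le :: "'f elt \<Rightarrow> 'f elt \<Rightarrow> bool" where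
  "value_le MInf f \<longleftrightarrow> True"
| "value_le (Elt l a) MInf \<longleftrightarrow> False"
| "value_le (Elt l a) (Elt m b) \<longleftrightarrow> a \<le> b"

lemma value_le_refl [simp]: "value_le e e"
  by (cases e) auto

lemma value_le_trans: "value_le e f \<Longrightarrow> value_le f g \<Longrightarrow> value_le e g"
  by (cases e; cases f; cases g) auto

lemma value_le_mult:
  fixes e e' :: "'f::comm_ring_1 elt"
  shows "value_le e f \<Longrightarrow> value_le e' f' \<Longrightarrow> value_le (e * e') (f * f')"
  by (cases e; cases f; cases e'; cases f') auto

lemma value_le_prod:
  fixes e :: "'i \<Rightarrow> 'f::comm_ring_1 elt"
  assumes "\<And>i. i \<in> I \<Longrightarrow> value_le (e i) (f i)"
  shows "value_le (prod e I) (prod f I)"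
  using assms by (induction I rule: infinite_finite_induct) (auto simp: value_le_mult)

lemma value_le_sum:
  fixes e :: "'i \<Rightarrow> 'f::comm_ring_1 elt"
  assumes "\<And>i. i \<in> I \<Longrightarrow> value_le (e i) f"
  shows "value_le (sum e I) f"
proof -
  have add: "value_le a f \<Longrightarrow> value_le b f \<Longrightarrow> value_le (a + b) f" for a b :: "'f elt"
    by (cases a; cases b; cases f) auto
  show ?thesis
    using assms by (induction I rule: infinite_finite_induct) (auto simp: add zero_elt_def)
qed

lemma value_le_sum_member:
  fixes e :: "'i \<Rightarrow> 'f::comm_ring_1 elt"
  assumes "finite I" "i \<in> I"
  shows "value_le (e i) (sum e I)"
proof -
  have "value_le a (a + b)" for a b :: "'f elt" by (cases a; cases b) auto
  then show ?thesis using assms by (simp add: sum.remove)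
qed

lemma sum_value_attained:
  fixes e :: "'i \<Rightarrow> 'f::comm_ring_1 elt"
  assumes "finite I" "sum e I = Elt l a"
  shows "\<exists>i\<in>I. \<exists>m. e i = Elt m a"
  using assms
proof (induction I arbitrary: l rule: finite_induct)
  case empty
  then show ?case by (simp add: zero_elt_def)
next
  case (insert i I)
  then show ?case by (cases "e i"; cases "sum e I") (auto split: if_splits)
qed

section \<open>Determinants and kernels over an integral domain\<close>

lemma to_fract_sum: "to_fract (sum f I) = (\<Sum>i\<in>I. to_fract (f i))"
  by (induction I rule: infinite_finite_induct) auto

lemma to_fract_prod: "to_fract (prod f I) = (\<Prod>i\<in>I. to_fract (f i))"
  by (induction I rule: infinite_finite_induct) auto

lemma to_fract_det:
  fixes X :: "'a::idom ^ 'n ^ 'n"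
  shows "det (\<chi> i j. to_fract (X $ i $ j)) = to_fract (det X)"
  unfolding det_def to_fract_sum
  by (intro sum.cong) (auto simp: to_fract_prod sign_def)

text \<open>
  Multiplying a kernel vector over the fraction field by such a \<open>d\<close> brings it back into the domain.
\<close>

lemma common_denominator:
  fixes x :: "'i \<Rightarrow> 'a::idom fract"
  assumes "finite I"
  shows "\<exists>d c. d \<noteq> 0 \<and> (\<forall>i\<in>I. to_fract d * x i = to_fract (c i))"
  using assms
proof (induction I rule: finite_induct)
  case empty
  show ?case by (auto intro: exI[of _ 1])
next
  case (insert k I)
  then obtain d c where d: "d \<noteq> 0" and c: "\<forall>i\<in>I. to_fract d * x i = to_fract (c i)" by blast
  obtain p q where xk: "x k = Fract p q" and q: "q \<noteq> 0" by (cases "x k") auto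
  have k: "to_fract (d * q) * x k = to_fract (d * p)"
    using q by (simp add: xk to_fract_def eq_fract)
  have "to_fract (d * q) * x i = to_fract (q * c i)" if "i \<in> I" for i
    using c that by (simp add: mult_ac)
  with k insert.hyps d q show ?case
    by (intro exI[of _ "d * q"] exI[of _ "\<lambda>i. if i = k then d * p else q * c i"]) auto
qed

lemma det_eq_0_iff_kernel:
  fixes X :: "'a::idom ^ 'n ^ 'n"
  shows "det X = 0 \<longleftrightarrow> (\<exists>c. c \<noteq> 0 \<and> X *v c = 0)"
proof -
  let ?F = "(\<chi> i j. to_fract (X $ i $ j)) :: 'a fract ^ 'n ^ 'n"
  have F: "det X = 0 \<longleftrightarrow> (\<exists>x. x \<noteq> 0 \<and> ?F *v x = 0)"
    using invertible_det_nz[of ?F] to_fract_det[of X]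
    by (auto simp: invertible_left_inverse matrix_left_invertible_ker)
  show ?thesis
  proof
    assume "det X = 0"
    then obtain x where x: "x \<noteq> 0" "?F *v x = 0" using F by blast
    obtain d c where d: "d \<noteq> 0" and c: "\<And>i. to_fract d * x $ i = to_fract (c i)"
      using common_denominator[of UNIV "\<lambda>i. x $ i"] by auto
    obtain i where "x $ i \<noteq> 0" using x by (auto simp: vec_eq_iff)
    with c[of i] d have "c i \<noteq> 0" by auto
    moreover have "(\<Sum>j\<in>UNIV. X $ i $ j * c j) = 0" for i
    proof -
      have "to_fract (\<Sum>j\<in>UNIV. X $ i $ j * c j) = to_fract d * (?F *v x) $ i"
        by (simp add: to_fract_sum matrix_vector_mult_def sum_distrib_left flip: c)
           (simp add: mult_ac)
      also have "\<dots> = 0" by (simp only: x zero_index mult_zero_right)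
      finally show ?thesis by (simp only: to_fract_eq_0_iff)
    qed
    ultimately show "\<exists>c. c \<noteq> 0 \<and> X *v c = 0"
      by (intro exI[of _ "\<chi> i. c i"]) (auto simp: vec_eq_iff matrix_vector_mult_def)
  next
    assume "\<exists>c. c \<noteq> 0 \<and> X *v c = 0"
    then obtain c where c: "c \<noteq> 0" "X *v c = 0" by blast
    have "?F *v (\<chi> i. to_fract (c $ i)) = (\<chi> i. to_fract ((X *v c) $ i))"
      by (simp add: vec_eq_iff matrix_vector_mult_def to_fract_sum)
    with c have "(\<chi> i. to_fract (c $ i)) \<noteq> 0 \<and> ?F *v (\<chi> i. to_fract (c $ i)) = 0"
      by (auto simp: vec_eq_iff)
    then show "det X = 0" using F by blast
  qed
qed

text \<open>
  Laplace expansion along row \<open>k\<close>, with the cofactors written as determinants in which that row is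
  replaced by a unit vector. Inserting a row \<open>y\<close> of \<open>Y\<close> other than row \<open>k\<close> gives \<open>0\<close>, inserting row \<open>k\<close>
  itself gives \<open>det Y\<close>.
\<close>

lemma sum_cofactors:
  fixes Y :: "'a::comm_ring_1 ^ 'n ^ 'n"
  shows "(\<Sum>j\<in>UNIV. y $ j * det (\<chi> i. if i = k then axis j 1 else Y $ i)) =
         det (\<chi> i. if i = k then y else Y $ i)"
proof -
  have y: "y = (\<Sum>j\<in>UNIV. y $ j *s axis j 1)"
    by (simp add: basis_expansion)
  have "det (\<chi> i. if i = k then y else Y $ i) =
        det (\<chi> i. if i = k then (\<Sum>j\<in>UNIV. y $ j *s axis j 1) else Y $ i)"
    using arg_cong[OF y, of "\<lambda>v. det (\<chi> i. if i = k then v else Y $ i)"] .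
  also have "\<dots> = (\<Sum>j\<in>UNIV. det (\<chi> i. if i = k then y $ j *s axis j 1 else Y $ i))"
    by (rule det_linear_row_sum) simp
  also have "\<dots> = (\<Sum>j\<in>UNIV. y $ j * det (\<chi> i. if i = k then axis j 1 else Y $ i))"
    by (simp only: det_row_mul)
  finally show ?thesis ..
qed

lemma det_monomial_matrix:
  fixes a :: "'n::finite \<Rightarrow> 'a::comm_ring_1"
  assumes "\<tau> permutes UNIV"
  shows "det (\<chi> i j. if j = \<tau> i then a i else 0) = of_int (sign \<tau>) * prod a UNIV"
proof -
  have zero: "(\<Prod>i\<in>UNIV. if p i = \<tau> i then a i else 0) = 0" if ne: "p \<noteq> \<tau>" for p
  proof -
    obtain i where "p i \<noteq> \<tau> i" using ne by auto
    then show ?thesis by (intro prod_zero) auto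
  qed
  have "det (\<chi> i j. if j = \<tau> i then a i else 0) =
      (\<Sum>p\<in>{p. p permutes UNIV}. if p = \<tau> then of_int (sign \<tau>) * prod a UNIV else 0)"
    unfolding det_def by (intro sum.cong) (auto simp: zero)
  then show ?thesis using assms by simp
qed

text \<open>
  Multilinearity in the rows of \<open>S\<close>: each of them contributes either \<open>x i\<close> or \<open>g *s d i\<close>. The rows \<open>z i\<close>
  outside \<open>S\<close> are arbitrary so that the induction can fix the choice made in the row just removed
  from \<open>S\<close>.
\<close>

lemma det_add_rows:
  fixes x d z :: "'n::finite \<Rightarrow> 'a::comm_ring_1 ^ 'n"
  assumes "finite S"
  shows "det (\<chi> i. if i \<in> S then x i + g *s d i else z i) =
         (\<Sum>T\<in>Pow S. g ^ card T * det (\<chi> i. if i \<in> T then d i else if i \<in> S then x i else z i))"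
  using assms
proof (induction S arbitrary: z rule: finite_induct)
  case empty
  show ?case by simp
next
  case (insert k S)
  let ?E = "\<lambda>z T. g ^ card T * det (\<chi> i. if i \<in> T then d i else if i \<in> S then x i else z i)"
  have upd: "(\<chi> i. if i = k then v else if i \<in> S then x i + g *s d i else z i) =
             (\<chi> i. if i \<in> S then x i + g *s d i else (z(k := v)) i)" for v
    using insert.hyps by (auto simp: vec_eq_iff)
  have "det (\<chi> i. if i \<in> insert k S then x i + g *s d i else z i) =
        det (\<chi> i. if i = k then x i + g *s d i else if i \<in> S then x i + g *s d i else z i)"
    by (intro arg_cong[where f = det]) (auto simp: vec_eq_iff)
  also have "\<dots> = det (\<chi> i. if i = k then x k else if i \<in> S then x i + g *s d i else z i) +
      g * det (\<chi> i. if i = k then d k else if i \<in> S then x i + g *s d i else z i)"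
    by (simp only: det_row_add det_row_mul cong: if_cong)
  also have "\<dots> = sum (?E (z(k := x k))) (Pow S) + g * sum (?E (z(k := d k))) (Pow S)"
    by (simp only: upd insert.IH)
  also have "sum (?E (z(k := x k))) (Pow S) = (\<Sum>T\<in>Pow S. g ^ card T *
      det (\<chi> i. if i \<in> T then d i else if i \<in> insert k S then x i else z i))"
    by (intro sum.cong refl arg_cong2[where f = "(*)"] arg_cong[where f = det]) (use insert.hyps in \<open>auto simp: vec_eq_iff\<close>)
  also have "g * sum (?E (z(k := d k))) (Pow S) = (\<Sum>T\<in>Pow S. g ^ card (insert k T) *
      det (\<chi> i. if i \<in> insert k T then d i else if i \<in> insert k S then x i else z i))"
    unfolding sum_distrib_left
  proof (rule sum.cong)
    fix T assume T: "T \<in> Pow S"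
    then have "finite T" "k \<notin> T" using insert.hyps by (auto intro: finite_subset)
    moreover have "(\<chi> i. if i \<in> T then d i else if i \<in> S then x i else (z(k := d k)) i) =
      (\<chi> i. if i \<in> insert k T then d i else if i \<in> insert k S then x i else z i)"
      using T insert.hyps by (auto simp: vec_eq_iff)
    ultimately show "g * ?E (z(k := d k)) T = g ^ card (insert k T) *
      det (\<chi> i. if i \<in> insert k T then d i else if i \<in> insert k S then x i else z i)"
      by (simp add: mult.assoc)
  qed simp
  also have "\<dots> = (\<Sum>T\<in>insert k ` Pow S. g ^ card T *
      det (\<chi> i. if i \<in> T then d i else if i \<in> insert k S then x i else z i))"
    by (subst sum.reindex) (use insert.hyps in \<open>auto simp: inj_on_def\<close>)
  finally show ?case
    unfolding Pow_insert by (subst sum.union_disjoint) (use insert.hyps in auto)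
qed

section \<open>Dependent columns have a determinant of layer zero\<close>

text \<open>
  Take monomial lifts; layer \<open>0\<close> says that the sum \<open>r\<close> of the lifted products lies strictly below
  the largest value \<open>W\<close>. Some product \<open>u k * a k\<close> attains \<open>W\<close>, and \<open>u k\<close> lifts to an invertible monomial.
  Subtracting \<open>r\<close> divided by this monomial from the lift of \<open>a k\<close> changes it only below its value, so it
  remains a lift.
\<close>

lemma lift_row_annihilated:
  fixes a u :: "'n \<Rightarrow> 'f::field elt"
  assumes J: "finite J" "\<And>j. j \<in> J \<Longrightarrow> u j \<in> elt_units"
    and layer: "layer (\<Sum>j\<in>J. u j * a j) = 0"
  shows "\<exists>y. (\<forall>j. lifts (y j) (a j)) \<and> (\<Sum>j\<in>J. y j * monomial (u j)) = 0"
proof -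
  let ?x = "\<lambda>j. monomial (a j)"
  define r where "r = (\<Sum>j\<in>J. ?x j * monomial (u j))"
  have r: "lifts r (\<Sum>j\<in>J. u j * a j)"
    unfolding r_def by (subst mult.commute) (intro lifts_sum lifts_mult lifts_monomial)
  show ?thesis
  proof (cases "\<Sum>j\<in>J. u j * a j")
    case MInf
    with r show ?thesis by (intro exI[of _ ?x]) (auto simp: lifts_monomial r_def)
  next
    case (Elt l W)
    with layer have l: "l = 0" by simp
    obtain k m where k: "k \<in> J" "u k * a k = Elt m W"
      using sum_value_attained[OF J(1) Elt] by blast
    obtain c \<gamma> where u: "u k = Elt c \<gamma>" "c \<noteq> 0" using J(2)[OF k(1)] by (auto simp: elt_units_def)
    obtain b p where a: "a k = Elt p b" "\<gamma> + b = W" using k u by (cases "a k") auto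
    \<comment> \<open>The correction of entry \<open>k\<close>; multiplied by the monomial of \<open>u k\<close> it gives \<open>- r\<close>.\<close>
    define v where "v = - (r * term_at (- \<gamma>) (inverse c))"
    have inv: "term_at (- \<gamma>) (inverse c) * monomial (u k) = 1"
      using u by (simp add: mult_single flip: single_one)
    have "lifts (r * term_at (- \<gamma>) (inverse c)) (Elt 0 W * Elt (inverse c) (- \<gamma>))"
      using r Elt l by (intro lifts_mult) (auto simp: lookup_single)
    then have "lifts v (Elt 0 b)" using a by (auto simp: v_def)
    then have "lifts (?x k + v) (a k + Elt 0 b)" by (intro lifts_add lifts_monomial)
    then have "\<forall>j. lifts ((?x(k := ?x k + v)) j) (a j)"
      using a by (auto simp: lifts_monomial)
    moreover have "(\<Sum>j\<in>J. (?x(k := ?x k + v)) j * monomial (u j)) = r + v * monomial (u k)"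
      using J(1) k(1) by (simp add: r_def sum.remove[of J k] algebra_simps)
    moreover have "r + v * monomial (u k) = 0"
      using inv by (simp add: v_def mult.assoc)
    ultimately show ?thesis by metis
  qed
qed

text \<open>
  The corrected rows of \<open>lift_row_annihilated\<close> form a singular lift of \<open>A\<close>, and \<open>0\<close> lifts only elements
  of layer \<open>0\<close>.
\<close>

lemma layer_det_of_dependent_columns:
  fixes A :: "'f::field elt ^ 'n ^ 'n"
  assumes "elt_dependent (\<lambda>j. column j A)"
  shows "layer (elt_det A) = 0"
proof -
  obtain J u where J: "finite J" "J \<noteq> {}" "\<And>j. j \<in> J \<Longrightarrow> u j \<in> elt_units"
    and dep: "layer_vec (\<Sum>j\<in>J. u j *s column j A) = 0"
    using assms by (auto simp: elt_dependent_def)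
  have "layer (\<Sum>j\<in>J. u j * A $ i $ j) = 0" for i
    using dep by (auto simp: layer_vec_def vec_eq_iff column_def)
  then have "\<exists>y. (\<forall>j. lifts (y j) (A $ i $ j)) \<and> (\<Sum>j\<in>J. y j * monomial (u j)) = 0" for i
    using lift_row_annihilated[of J u "\<lambda>j. A $ i $ j"] J by simp
  then obtain y where y: "\<And>i j. lifts (y i j) (A $ i $ j)"
      "\<And>i. (\<Sum>j\<in>J. y i j * monomial (u j)) = 0" by metis
  define X where "X = (\<chi> i j. y i j)"
  define c where "c = (\<chi> j. if j \<in> J then monomial (u j) else 0)"
  have "X *v c = 0"
    using y(2) by (simp add: X_def c_def vec_eq_iff matrix_vector_mult_def if_distrib sum.If_cases cong: if_cong)
  moreover have "c \<noteq> 0"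
  proof -
    obtain j where j: "j \<in> J" using J by blast
    then obtain l a where "u j = Elt l a" "l \<noteq> 0" using J(3)[of j] by (auto simp: elt_units_def)
    with j have "coeff_at (c $ j) a \<noteq> 0" by (simp add: c_def)
    then show ?thesis by auto
  qed
  ultimately have "det X = 0" using det_eq_0_iff_kernel by blast
  moreover have "lifts (det X) (elt_det A)"
    by (rule lifts_det) (simp add: X_def y)
  ultimately show ?thesis by (cases "elt_det A") auto
qed

section \<open>A determinant of layer zero yields dependent columns\<close>

text \<open>
  The coefficients of the dependence are the leading terms of the nonzero entries of \<open>c\<close>. In row \<open>k\<close>
  the layer of their combination is the coefficient of \<open>(Y *v c) $ k\<close> at the largest value \<open>W\<close> of that
  row. By \<open>low\<close> a nonzero coefficient can only occur strictly below some \<open>b + w\<close>, which is at most \<open>W\<close>.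
\<close>

lemma dependent_columnsI:
  fixes A :: "'f::field elt ^ 'n ^ 'n"
  assumes Y: "\<And>i j. lifts (Y $ i $ j) (A $ i $ j)" and c: "c \<noteq> 0"
    and low: "\<And>k \<nu>. coeff_at ((Y *v c) $ k) \<nu> \<noteq> 0 \<Longrightarrow>
                \<exists>j b l w. coeff_at (c $ j) b \<noteq> 0 \<and> A $ k $ j = Elt l w \<and> \<nu> < b + w"
  shows "elt_dependent (\<lambda>j. column j A)"
proof -
  define J where "J = {j. c $ j \<noteq> 0}"
  define top where "top j = Max (Poly_Mapping.keys (c $ j))" for j
  define u where "u j = Elt (coeff_at (c $ j) (top j)) (top j)" for j
  have le_top: "b \<le> top j" if "coeff_at (c $ j) b \<noteq> 0" for j b
    using that unfolding top_def by (intro Max_ge) (auto simp: in_keys_iff)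
  have top: "coeff_at (c $ j) (top j) \<noteq> 0" if "j \<in> J" for j
  proof -
    have "top j \<in> Poly_Mapping.keys (c $ j)"
      unfolding top_def using that by (intro Max_in) (auto simp: J_def)
    then show ?thesis by (simp add: in_keys_iff)
  qed
  have lift_u: "lifts (c $ j) (u j)" for j
    using le_top[of j] by (force simp: u_def)
  have "layer (\<Sum>j\<in>J. u j * A $ k $ j) = 0" for k
  proof (rule ccontr)
    assume nz: "layer (\<Sum>j\<in>J. u j * A $ k $ j) \<noteq> 0"
    then obtain l W where sum: "(\<Sum>j\<in>J. u j * A $ k $ j) = Elt l W" and "l \<noteq> 0"
      by (cases "\<Sum>j\<in>J. u j * A $ k $ j") auto
    have "(Y *v c) $ k = (\<Sum>j\<in>J. c $ j * Y $ k $ j)"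
      by (auto simp: matrix_vector_mult_def J_def mult.commute intro!: sum.mono_neutral_right)
    also have "lifts \<dots> (\<Sum>j\<in>J. u j * A $ k $ j)"
      by (intro lifts_sum lifts_mult lift_u Y)
    finally have "coeff_at ((Y *v c) $ k) W \<noteq> 0" using sum \<open>l \<noteq> 0\<close> by simp
    then obtain j b m w where j: "coeff_at (c $ j) b \<noteq> 0" "A $ k $ j = Elt m w" "W < b + w"
      using low by blast
    then have "j \<in> J" by (auto simp: J_def)
    then have "value_le (u j * A $ k $ j) (Elt l W)"
      unfolding sum[symmetric] by (intro value_le_sum_member) auto
    with j le_top[OF j(1)] show False by (simp add: u_def)
  qed
  moreover have "J \<noteq> {}" using c by (auto simp: J_def vec_eq_iff)
  moreover have "\<forall>j\<in>J. u j \<in> elt_units" using top by (auto simp: elt_units_def u_def)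
  ultimately show ?thesis
    unfolding elt_dependent_def
    by (intro exI[of _ J] exI[of _ u]) (auto simp: layer_vec_def vec_eq_iff column_def)
qed

text \<open>
  The supports are finite, so a fixed \<open>\<delta>\<close> separates \<open>M\<close> from all smaller exponents. It leaves room for the
  perturbation.
\<close>

lemma coeff_gap:
  fixes Q :: "'i::finite \<Rightarrow> (real \<Rightarrow>\<^sub>0 'f::zero)"
  shows "\<exists>\<delta>>0. \<forall>U \<nu>. coeff_at (Q U) \<nu> \<noteq> 0 \<longrightarrow> \<nu> < M \<longrightarrow> \<nu> < M - \<delta>"
proof -
  \<comment> \<open>\<open>M - 1\<close> only serves to make the set nonempty, so that it has a maximum.\<close>
  define B where "B = insert (M - 1) ((\<Union>U. Poly_Mapping.keys (Q U)) \<inter> {..<M})"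
  have B: "finite B" "B \<noteq> {}" "\<And>b. b \<in> B \<Longrightarrow> b < M" by (auto simp: B_def)
  then have "Max B < M" by simp
  moreover have "\<nu> \<le> Max B" if "coeff_at (Q U) \<nu> \<noteq> 0" "\<nu> < M" for U \<nu>
    using that B by (intro Max_ge) (auto simp: B_def in_keys_iff)
  ultimately show ?thesis
    by (intro exI[of _ "(M - Max B) / 2"]) (fastforce simp: field_simps)
qed

definition perturb_rows ::
    "'n set \<Rightarrow> 'a \<Rightarrow> ('n \<Rightarrow> 'a ^ 'n) \<Rightarrow> 'a::comm_ring_1 ^ 'n ^ 'n \<Rightarrow> 'a ^ 'n ^ 'n" where
  "perturb_rows S g d X = (\<chi> i. if i \<in> S then X $ i + g *s d i else X $ i)"

text \<open>
  \<open>Q T\<close> is the determinant after the rows in \<open>T\<close> have been replaced by those of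
  \<open>d\<close>. Take \<open>S\<close> minimal such that \<open>Q S\<close> reaches the exponent
  \<open>M\<close>; it is nonempty, and for a proper subset \<open>T\<close> of \<open>S\<close> all exponents
  of \<open>Q T\<close> are below \<open>M - \<delta>\<close>, with one \<open>\<delta> > 0\<close> for all
  \<open>T\<close>. Add \<open>t^(- \<epsilon>) d\<close> to the rows in \<open>S\<close>, with
  \<open>\<epsilon> |S| = \<delta>\<close>, and expand. In the determinant the term of \<open>T\<close> is
  \<open>t^(- \<epsilon> |T|) Q T\<close>: for \<open>T = S\<close> it reaches at most
  \<open>M - \<epsilon> |S|\<close>, and the others stay below \<open>M - \<delta>\<close>. If row
  \<open>k \<in> S\<close> is replaced by \<open>d k\<close>, one factor \<open>t^(- \<epsilon>)\<close> is
  saved: the term of \<open>S - {k}\<close> has a nonzero coefficient at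
  \<open>D = M - \<epsilon> (|S| - 1)\<close>, and no other term reaches \<open>D\<close>.
\<close>

lemma perturbation_with_small_det:
  fixes X :: "(real \<Rightarrow>\<^sub>0 'f::field) ^ 'n ^ 'n" and d :: "'n \<Rightarrow> (real \<Rightarrow>\<^sub>0 'f) ^ 'n"
  assumes Q: "\<And>T. Q T = det (\<chi> i. if i \<in> T then d i else X $ i)"
    and bound: "\<And>T \<nu>. \<nu> > M \<Longrightarrow> coeff_at (Q T) \<nu> = 0"
    and none: "coeff_at (Q {}) M = 0" and all: "coeff_at (Q UNIV) M \<noteq> 0"
  shows "\<exists>\<epsilon>>0. \<exists>k S D.
    coeff_at (det (\<chi> i. if i = k then d k else perturb_rows S (term_at (- \<epsilon>) 1) d X $ i)) D \<noteq> 0 \<and>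
    (\<forall>\<nu>\<ge>D. coeff_at (det (perturb_rows S (term_at (- \<epsilon>) 1) d X)) \<nu> = 0)"
proof -
  obtain S where S: "coeff_at (Q S) M \<noteq> 0" and S_min: "\<And>T. T \<subset> S \<Longrightarrow> coeff_at (Q T) M = 0"
  proof -
    have "finite {T. coeff_at (Q T) M \<noteq> 0}" "UNIV \<in> {T. coeff_at (Q T) M \<noteq> 0}" using all by auto
    from finite_has_minimal2[OF this] show ?thesis using that by blast
  qed
  have "S \<noteq> {}" using S none by auto
  then obtain k where k: "k \<in> S" by blast
  obtain \<delta> where \<delta>: "\<delta> > 0" "\<And>T \<nu>. coeff_at (Q T) \<nu> \<noteq> 0 \<Longrightarrow> \<nu> < M \<Longrightarrow> \<nu> < M - \<delta>"
    using coeff_gap[of Q M] by blast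
  define \<epsilon> where "\<epsilon> = \<delta> / card S"
  have cS: "card S > 0" using k by (auto simp: card_gt_0_iff)
  have \<epsilon>: "\<epsilon> > 0" "\<delta> = \<epsilon> * card S" using \<delta> cS by (auto simp: \<epsilon>_def)
  define D where "D = M - \<epsilon> * (real (card S) - 1)"
  have D_ge: "M - \<delta> \<le> D" using \<epsilon> by (simp add: D_def algebra_simps)
  have gap: "coeff_at (Q T) (\<nu> + m * \<epsilon>) = 0" if "T \<subset> S" "\<nu> \<ge> D" for T \<nu> and m :: nat
  proof -
    have "\<nu> + m * \<epsilon> \<ge> M - \<delta>" using that(2) D_ge \<epsilon>(1) by (smt (verit) mult_nonneg_nonneg of_nat_0_le_iff)
    then show ?thesis
      using \<delta>(2)[of T "\<nu> + m * \<epsilon>"] S_min[OF that(1)] bound[of "\<nu> + m * \<epsilon>" T] by force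
  qed
  have pow: "term_at (- \<epsilon>) (1::'f) ^ m = term_at (- (m * \<epsilon>)) 1" for m
    by (induction m) (auto simp: mult_single algebra_simps)
  have coeff: "coeff_at (term_at (- \<epsilon>) 1 ^ m * x) \<nu> = coeff_at x (\<nu> + m * \<epsilon>)"
    for m \<nu> and x :: "real \<Rightarrow>\<^sub>0 'f"
    by (simp add: pow coeff_at_term_mult)
  let ?Y = "perturb_rows S (term_at (- \<epsilon>) 1) d X"
  let ?Yk = "(\<chi> i. if i = k then d k else ?Y $ i) :: (real \<Rightarrow>\<^sub>0 'f) ^ 'n ^ 'n"
  have det_Y: "det ?Y = (\<Sum>T\<in>Pow S. term_at (- \<epsilon>) 1 ^ card T * Q T)"
    unfolding perturb_rows_def by (subst det_add_rows) (simp_all add: Q cong: if_cong)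
  have det_Yk: "det ?Yk = (\<Sum>T\<in>Pow (S - {k}). term_at (- \<epsilon>) 1 ^ card T * Q (insert k T))"
  proof -
    \<comment> \<open>Row \<open>k\<close> counts as an unperturbed row that is equal to \<open>d k\<close>.\<close>
    have "?Yk = (\<chi> i. if i \<in> S - {k} then X $ i + term_at (- \<epsilon>) 1 *s d i
                       else if i = k then d i else X $ i)"
      by (auto simp: vec_eq_iff perturb_rows_def)
    then have "det ?Yk = (\<Sum>T\<in>Pow (S - {k}). term_at (- \<epsilon>) 1 ^ card T *
        det (\<chi> i. if i \<in> T then d i else if i \<in> S - {k} then X $ i else if i = k then d i else X $ i))"
      by (simp only: det_add_rows[OF finite])
    moreover have "(\<chi> i. if i \<in> T then d i else if i \<in> S - {k} then X $ i else if i = k then d i else X $ i)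
        = (\<chi> i. if i \<in> insert k T then d i else X $ i)" for T
      by (auto simp: vec_eq_iff)
    ultimately show ?thesis by (simp only: Q)
  qed
  have low: "coeff_at (det ?Y) \<nu> = 0" if \<nu>: "\<nu> \<ge> D" for \<nu>
    unfolding det_Y lookup_sum coeff
  proof (rule sum.neutral, rule ballI)
    fix T assume T: "T \<in> Pow S"
    show "coeff_at (Q T) (\<nu> + card T * \<epsilon>) = 0"
    proof (cases "T = S")
      case True
      with \<nu> \<epsilon>(1) show ?thesis by (intro bound) (simp add: D_def algebra_simps)
    next
      case False
      with T \<nu> show ?thesis by (intro gap) auto
    qed
  qed
  have "coeff_at (det ?Yk) D = (\<Sum>T\<in>Pow (S - {k}). if T = S - {k} then coeff_at (Q S) M else 0)"
    unfolding det_Yk lookup_sum coeff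
  proof (rule sum.cong)
    fix T assume T: "T \<in> Pow (S - {k})"
    show "coeff_at (Q (insert k T)) (D + card T * \<epsilon>) = (if T = S - {k} then coeff_at (Q S) M else 0)"
    proof (cases "T = S - {k}")
      case True
      then have "insert k T = S" using k by auto
      moreover have "real (card T) = real (card S) - 1" using True k cS by (simp add: of_nat_diff)
      then have "D + card T * \<epsilon> = M" by (simp add: D_def)
      ultimately show ?thesis using True by simp
    next
      case False
      with T k have "insert k T \<subset> S" by auto
      then show ?thesis using False gap[of "insert k T" D "card T"] by simp
    qed
  qed simp
  then have "coeff_at (det ?Yk) D \<noteq> 0" using S by simp
  with \<epsilon>(1) low show ?thesis by blast
qed

lemma optimal_permutation:
  fixes A :: "'f::comm_ring_1 elt ^ 'n ^ 'n"
  assumes "elt_det A \<noteq> MInf"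
  obtains \<tau> where "\<tau> permutes UNIV" "(\<Prod>i\<in>UNIV. A $ i $ \<tau> i) \<noteq> MInf"
    "\<And>\<sigma>. \<sigma> permutes UNIV \<Longrightarrow> value_le (\<Prod>i\<in>UNIV. A $ i $ \<sigma> i) (\<Prod>i\<in>UNIV. A $ i $ \<tau> i)"
proof -
  define W where "W \<sigma> = (\<Prod>i\<in>UNIV. A $ i $ \<sigma> i)" for \<sigma> :: "'n \<Rightarrow> 'n"
  define P where "P = {\<sigma>. \<sigma> permutes (UNIV :: 'n set) \<and> W \<sigma> \<noteq> MInf}"
  define val :: "'f elt \<Rightarrow> real" where "val e = (case e of MInf \<Rightarrow> 0 | Elt l a \<Rightarrow> a)" for e
  have fin: "finite P" unfolding P_def by (rule finite_subset[OF _ finite_permutations[of UNIV]]) auto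
  have "P \<noteq> {}"
  proof
    assume "P = {}"
    then have "elt_det A = (\<Sum>p\<in>{p. p permutes (UNIV :: 'n set)}. 0)"
      unfolding elt_det_def by (intro sum.cong) (auto simp: P_def W_def zero_elt_def)
    then have "elt_det A = 0" by (simp only: sum.neutral_const)
    with assms show False by (simp add: zero_elt_def)
  qed
  with fin have "Max ((val \<circ> W) ` P) \<in> (val \<circ> W) ` P" by (intro Max_in) auto
  then obtain \<tau> where \<tau>: "\<tau> \<in> P" "val (W \<tau>) = Max ((val \<circ> W) ` P)" by auto
  have "value_le (W \<sigma>) (W \<tau>)" if "\<sigma> permutes UNIV" for \<sigma>
  proof (cases "W \<sigma> = MInf")
    case False
    with that have "val (W \<sigma>) \<le> val (W \<tau>)" unfolding \<tau>(2) using fin by (intro Max_ge) (auto simp: P_def)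
    with \<tau>(1) False show ?thesis by (cases "W \<sigma>"; cases "W \<tau>") (auto simp: val_def P_def)
  qed simp
  with \<tau>(1) show ?thesis using that[of \<tau>] by (auto simp: P_def W_def)
qed

lemma prod_elt_finite:
  fixes e :: "'i \<Rightarrow> 'f::comm_ring_1 elt"
  assumes "prod e I = Elt l a" "finite I"
  shows "(\<forall>i\<in>I. \<exists>l w. e i = Elt l w)"
  using assms
proof (induction I arbitrary: l a rule: infinite_finite_induct)
  case (insert i I)
  then show ?case by (cases "e i"; cases "prod e I") auto
qed auto

lemma prod_Elt:
  "(\<Prod>i\<in>I. Elt (l i) (w i)) = Elt (prod l I) (sum w I :: real)" 
  for l :: "'i \<Rightarrow> 'f::comm_ring_1"
  by (induction I rule: infinite_finite_induct) (auto simp: one_elt_def)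

text \<open>
  The rows \<open>d i\<close> used for the perturbation are \<open>t^(w i)\<close> times the unit vector at \<open>\<tau> i\<close>, where \<open>w i\<close> is the
  value of the entry of \<open>A\<close> there. Replacing rows of \<open>A\<close> by the corresponding symbols therefore never
  raises the value of a permutation above the maximum \<open>M\<close>, and replacing all of them leaves the
  permutation matrix of \<open>\<tau>\<close>, whose determinant is a nonzero term at \<open>M\<close>. As \<open>\<epsilon>\<close> is positive, the
  perturbed matrix still lifts \<open>A\<close>.
\<close>

lemma dependent_columns_of_layer_det:
  fixes A :: "'f::field elt ^ 'n ^ 'n"
  assumes layer: "layer (elt_det A) = 0"
  shows "elt_dependent (\<lambda>j. column j A)"
proof -
  define X where "X = (\<chi> i j. monomial (A $ i $ j))"
  have X: "lifts (X $ i $ j) (A $ i $ j)" for i j by (simp add: X_def lifts_monomial)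
  show ?thesis
  proof (cases "elt_det A = MInf")
    case True
    with lifts_det[of X A] X have "det X = 0" by simp
    then obtain c where "c \<noteq> 0" "X *v c = 0" using det_eq_0_iff_kernel by blast
    then show ?thesis by (intro dependent_columnsI[of X A c] X) auto
  next
    case False
    obtain \<tau> where \<tau>: "\<tau> permutes UNIV" "(\<Prod>i\<in>UNIV. A $ i $ \<tau> i) \<noteq> MInf"
      and opt: "\<And>\<sigma>. \<sigma> permutes UNIV \<Longrightarrow> value_le (\<Prod>i\<in>UNIV. A $ i $ \<sigma> i) (\<Prod>i\<in>UNIV. A $ i $ \<tau> i)"
      using optimal_permutation[OF False] by blast
    have "\<forall>i. \<exists>l w. A $ i $ \<tau> i = Elt l w"
      using \<tau>(2) prod_elt_finite[of "\<lambda>i. A $ i $ \<tau> i" UNIV] by (cases "\<Prod>i\<in>UNIV. A $ i $ \<tau> i") auto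
    then obtain l w where A\<tau>: "\<And>i. A $ i $ \<tau> i = Elt (l i) (w i)" by metis
    define M where "M = sum w UNIV"
    define d where "d i = (\<chi> j. if j = \<tau> i then term_at (w i) (1::'f) else 0)" for i
    define Q where "Q T = det (\<chi> i. if i \<in> T then d i else X $ i)" for T
    define AT where "AT T = (\<chi> i j. if i \<in> T then if j = \<tau> i then Elt 1 (w i) else MInf else A $ i $ j)" for T
    have Q_lifts: "lifts (Q T) (elt_det (AT T))" for T
      unfolding Q_def by (rule lifts_det) (auto simp: AT_def d_def X lookup_single)
    have AT_le: "value_le (elt_det (AT T)) (Elt 1 M)" for T
      unfolding elt_det_def
    proof (rule value_le_sum)
      fix \<sigma> assume "\<sigma> \<in> {p. p permutes (UNIV :: 'n set)}"
      then have "value_le (\<Prod>i\<in>UNIV. A $ i $ \<sigma> i) (\<Prod>i\<in>UNIV. A $ i $ \<tau> i)" using opt by simp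
      moreover have "value_le (\<Prod>i\<in>UNIV. AT T $ i $ \<sigma> i) (\<Prod>i\<in>UNIV. A $ i $ \<sigma> i)"
        by (rule value_le_prod) (auto simp: AT_def A\<tau>)
      moreover have "value_le (\<Prod>i\<in>UNIV. A $ i $ \<tau> i) (Elt 1 M)"
        by (simp add: A\<tau> prod_Elt M_def)
      ultimately have "value_le (\<Prod>i\<in>UNIV. AT T $ i $ \<sigma> i) (Elt 1 M)"
        using value_le_trans by blast
      then show "value_le (Elt (of_int (sign \<sigma>)) 0 * (\<Prod>i\<in>UNIV. AT T $ i $ \<sigma> i)) (Elt 1 M)"
        by (cases "\<Prod>i\<in>UNIV. AT T $ i $ \<sigma> i") auto
    qed
    have bound: "coeff_at (Q T) \<nu> = 0" if "\<nu> > M" for T \<nu>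
      using Q_lifts[of T] AT_le[of T] that by (cases "elt_det (AT T)") auto
    have none: "coeff_at (Q {}) M = 0"
    proof -
      \<comment> \<open>If \<open>det A\<close> has value \<open>M\<close> this is the assumption on its layer; otherwise its value is below \<open>M\<close>.\<close>
      have "AT {} = A" by (simp add: AT_def vec_eq_iff)
      with Q_lifts[of "{}"] AT_le[of "{}"] layer show ?thesis
        by (cases "elt_det A") (auto simp: le_less)
    qed
    have "Q UNIV = of_int (sign \<tau>) * (\<Prod>i\<in>UNIV. term_at (w i) 1)"
      using det_monomial_matrix[OF \<tau>(1), of "\<lambda>i. term_at (w i) 1"] by (simp add: Q_def d_def)
    moreover have "lifts (of_int (sign \<tau>) * (\<Prod>i\<in>UNIV. term_at (w i) 1))
        (Elt (of_int (sign \<tau>) :: 'f) 0 * (\<Prod>i\<in>UNIV. Elt 1 (w i)))"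
      by (intro lifts_mult lifts_prod lifts_of_int) (auto simp: lookup_single)
    ultimately have all: "coeff_at (Q UNIV) M \<noteq> 0"
      by (simp add: prod_Elt M_def sign_def)
    obtain \<epsilon> k S D where \<epsilon>: "\<epsilon> > 0"
      and D: "coeff_at (det (\<chi> i. if i = k then d k else perturb_rows S (term_at (- \<epsilon>) 1) d X $ i)) D \<noteq> 0"
      and low: "\<And>\<nu>. \<nu> \<ge> D \<Longrightarrow> coeff_at (det (perturb_rows S (term_at (- \<epsilon>) 1) d X)) \<nu> = 0"
      using perturbation_with_small_det[of Q d X M, OF Q_def bound none all] by blast
    define Y where "Y = perturb_rows S (term_at (- \<epsilon>) 1) d X"
    define c where "c = (\<chi> j. det (\<chi> i. if i = k then axis j 1 else Y $ i))"
    have Y: "lifts (Y $ i $ j) (A $ i $ j)" for i j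
    proof (cases "i \<in> S \<and> j = \<tau> i")
      case True
      have "lifts (X $ i $ j + term_at (w i - \<epsilon>) 1) (Elt (l i) (w i))"
        using X[of i j] True A\<tau>[of i] \<epsilon> by (auto simp: lookup_add lookup_single when_def)
      with True A\<tau>[of i] show ?thesis by (simp add: Y_def perturb_rows_def d_def mult_single)
    next
      case False
      then show ?thesis using X[of i j] by (auto simp: Y_def perturb_rows_def d_def)
    qed
    have cof: "(\<Sum>j\<in>UNIV. y $ j * c $ j) = det (\<chi> i. if i = k then y else Y $ i)" for y
      using sum_cofactors[of y k Y] by (simp add: c_def)
    have "coeff_at (\<Sum>j\<in>UNIV. d k $ j * c $ j) D \<noteq> 0"
      using D by (simp only: cof Y_def not_False_eq_True)
    also have "(\<Sum>j\<in>UNIV. d k $ j * c $ j) = term_at (w k) 1 * c $ \<tau> k"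
      by (simp add: d_def if_distrib[of "\<lambda>x. x * _"] sum.delta cong: if_cong)
    finally have c\<tau>: "coeff_at (c $ \<tau> k) (D - w k) \<noteq> 0" by (simp add: coeff_at_term_mult)
    have row: "(Y *v c) $ i = (if i = k then det Y else 0)" for i
    proof -
      have *: "(Y *v c) $ i = det (\<chi> i'. if i' = k then Y $ i else Y $ i')"
        by (simp add: matrix_vector_mult_def cof)
      show ?thesis
      proof (cases "i = k")
        case True
        then have "(\<chi> i'. if i' = k then Y $ i else Y $ i') = Y" by (auto simp: vec_eq_iff)
        with * True show ?thesis by simp
      next
        case False
        then show ?thesis unfolding *
          by (simp, intro det_identical_rows[of i k]) (auto simp: row_def vec_eq_iff)
      qed
    qed
    show ?thesis
    proof (rule dependent_columnsI[OF Y])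
      show "c \<noteq> 0" using c\<tau> by auto
      fix i \<nu> assume nz: "coeff_at ((Y *v c) $ i) \<nu> \<noteq> 0"
      then have i: "i = k" by (auto simp: row split: if_splits)
      with nz have "coeff_at (det Y) \<nu> \<noteq> 0" by (simp add: row)
      then have "\<nu> < D" using low[of \<nu>] unfolding Y_def by force
      then show "\<exists>j b l w. coeff_at (c $ j) b \<noteq> 0 \<and> A $ i $ j = Elt l w \<and> \<nu> < b + w"
        using c\<tau> A\<tau> i by (intro exI[of _ "\<tau> k"] exI[of _ "D - w k"]) auto
    qed
  qed
qed

section \<open>Rows, columns and the determinant\<close>

lemma elt_det_transpose:
  fixes A :: "'f::comm_ring_1 elt ^ 'n ^ 'n"
  shows "elt_det (transpose A) = elt_det A"
proof -
  have "(\<Prod>i\<in>UNIV. A $ inv p i $ i) = (\<Prod>i\<in>UNIV. A $ i $ p i)"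
    if "p permutes UNIV" for p :: "'n \<Rightarrow> 'n"
    by (subst prod.permute[OF that]) (simp add: permutes_inverses[OF that])
  moreover have "sign (inv p) = sign p" if "p permutes UNIV" for p :: "'n \<Rightarrow> 'n"
    by (rule sign_inverse) (use that in \<open>auto simp: permutation_permutes\<close>)
  ultimately show ?thesis
    unfolding elt_det_def transpose_def
    by (subst sum_permutations_inverse) (intro sum.cong, simp_all)
qed

theorem theorem2p6:
  fixes A :: "'f::alg_closed_field elt ^ 'n ^ 'n"
  shows "(elt_dependent (\<lambda>i. row i A) \<longleftrightarrow> elt_dependent (\<lambda>j. column j A)) \<and>
         (elt_dependent (\<lambda>j. column j A) \<longleftrightarrow> layer (elt_det A) = 0)"
proof -
  have columns: "elt_dependent (\<lambda>j. column j B) \<longleftrightarrow> layer (elt_det B) = 0" for B :: "'f elt ^ 'n ^ 'n"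
    using layer_det_of_dependent_columns dependent_columns_of_layer_det by blast
  show ?thesis
    using columns[of A] columns[of "transpose A"] by (simp add: column_transpose elt_det_transpose)
qed

end
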